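(* For finite sets $N,X$ with $|N|=n$, $|X|=x$, let $i(n,x)$ be the number of partial injections between $N$ and $X$, and let $i^{l}(n,x)$ and $i^{r}(n,x)$ be the numbers of their orbits under $S_N$ and $S_X$ respectively; explicitly $i(n,x)=\sum_k\binom nk\binom xk k!$, $i^{l}(n,x)=\sum_{k=0}^{\min\{n,x\}}\binom xk$, $i^{r}(n,x)=\sum_{k=0}^{\min\{n,x\}}\binom nk$, and the number of $S_N\times S_X$-orbits is $1+\min\{n,x\}$. Then, as formal power series in $z,w$, $$\sum_{n,x\ge0}i(n,x)\frac{z^n}{n!}\frac{w^x}{x!}=e^{z+w+zw},$$ $$\sum_{n,x\ge0}i^{l}(n,x)z^nw^x=\frac1{(1-z)(1-w-zw)},$$ $$\sum_{n,x\ge0}i^{r}(n,x)z^nw^x=\frac1{(1-w)(1-z-zw)},$$ $$\sum_{n,x\ge0}\bigl(1+\min\{n,x\}\bigr)z^nw^x=\frac1{(1-z)(1-w)(1-zw)}.$$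
   Context: A partial injection between $N$ and $X$ is a relation $R\subseteq N\times X$ such that for every $a\in X$ there is at most one $i\in N$ with $(i,a)\in R$ and for every $i\in N$ there is at most one $a\in X$ with $(i,a)\in R$. The group $S_N\times S_X$ acts by $(\pi,\sigma)\cdot R=\{(\pi(i),\sigma(a)):(i,a)\in R\}$, and $S_N$, $S_X$ act by setting the other component to the identity. *)

theory Defs
  imports
    "HOL-Algebra.Group_Action"
    "HOL-Computational_Algebra.Formal_Power_Series"
    "HOL-Library.Groups_Big_Fun"
begin

definition partial_injections :: "'a set \<Rightarrow> 'b set \<Rightarrow> ('a \<times> 'b) set set" where
  "partial_injections N X =
     {R. R \<subseteq> N \<times> X \<and>
         (\<forall>a\<in>X. \<exists>\<^sub>\<le>\<^sub>1 i. i \<in> N \<and> (i, a) \<in> R) \<and>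
         (\<forall>i\<in>N. \<exists>\<^sub>\<le>\<^sub>1 a. a \<in> X \<and> (i, a) \<in> R)}"

(* The symmetric group of a set S is BijGroup S.  Its elements are extensional, and the action
   below is extensional on the partial injections too, as group_action requires. *)

definition pinj_act ::
    "'a set \<Rightarrow> 'b set \<Rightarrow> ('a \<Rightarrow> 'a) \<times> ('b \<Rightarrow> 'b) \<Rightarrow> ('a \<times> 'b) set \<Rightarrow> ('a \<times> 'b) set" where
  "pinj_act N X = (\<lambda>(\<pi>, \<sigma>). \<lambda>R \<in> partial_injections N X. {(\<pi> i, \<sigma> a) | i a. (i, a) \<in> R})"

definition pinj_act_left ::
    "'a set \<Rightarrow> 'b set \<Rightarrow> ('a \<Rightarrow> 'a) \<Rightarrow> ('a \<times> 'b) set \<Rightarrow> ('a \<times> 'b) set" where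
  "pinj_act_left N X \<pi> = pinj_act N X (\<pi>, \<one>\<^bsub>BijGroup X\<^esub>)"

definition pinj_act_right ::
    "'a set \<Rightarrow> 'b set \<Rightarrow> ('b \<Rightarrow> 'b) \<Rightarrow> ('a \<times> 'b) set \<Rightarrow> ('a \<times> 'b) set" where
  "pinj_act_right N X \<sigma> = pinj_act N X (\<one>\<^bsub>BijGroup N\<^esub>, \<sigma>)"

definition pinj_orbits :: "'a set \<Rightarrow> 'b set \<Rightarrow> ('a \<times> 'b) set set set" where
  "pinj_orbits N X =
     orbits (BijGroup N \<times>\<times> BijGroup X) (partial_injections N X) (pinj_act N X)"

definition pinj_orbits_left :: "'a set \<Rightarrow> 'b set \<Rightarrow> ('a \<times> 'b) set set set" where
  "pinj_orbits_left N X = orbits (BijGroup N) (partial_injections N X) (pinj_act_left N X)"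

definition pinj_orbits_right :: "'a set \<Rightarrow> 'b set \<Rightarrow> ('a \<times> 'b) set set set" where
  "pinj_orbits_right N X = orbits (BijGroup X) (partial_injections N X) (pinj_act_right N X)"

(* The counts as functions of two natural numbers are taken on the sets {..<n} and {..<x};
   independence of the choice of sets is part of the theorem. *)

definition num_pinj :: "nat \<Rightarrow> nat \<Rightarrow> nat" where
  "num_pinj n x = card (partial_injections {..<n} {..<x})"

definition num_pinj_left :: "nat \<Rightarrow> nat \<Rightarrow> nat" where
  "num_pinj_left n x = card (pinj_orbits_left {..<n} {..<x})"

definition num_pinj_right :: "nat \<Rightarrow> nat \<Rightarrow> nat" where
  "num_pinj_right n x = card (pinj_orbits_right {..<n} {..<x})"

definition num_pinj_both :: "nat \<Rightarrow> nat \<Rightarrow> nat" where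
  "num_pinj_both n x = card (pinj_orbits {..<n} {..<x})"

(* Formal power series in z, w are series in z whose coefficients are series in w: the
   coefficient of z^n w^x in F is fps_nth (fps_nth F n) x. *)

abbreviation fps_z :: "'r::comm_ring_1 fps fps" where
  "fps_z \<equiv> fps_X"

abbreviation fps_w :: "'r::comm_ring_1 fps fps" where
  "fps_w \<equiv> fps_const fps_X"

definition fps2 :: "(nat \<Rightarrow> nat \<Rightarrow> 'r) \<Rightarrow> 'r fps fps" where
  "fps2 a = Abs_fps (\<lambda>n. Abs_fps (\<lambda>x. a n x))"

(* exp F = sum over k of F^k / k!, coefficient by coefficient, for F without constant term; then
   only k <= n + x contribute to the coefficient of z^n w^x.  Neither fps_compose nor the
   topology on 'r fps fps can be used here: both require the z-free part of F (not just its
   constant term) to vanish. *)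
definition fps2_exp :: "'r::field_char_0 fps fps \<Rightarrow> 'r fps fps" where
  "fps2_exp F = fps2 (\<lambda>n x. Sum_any (\<lambda>k. fps_nth (fps_nth (F ^ k) n) x / fact k))"

end

theory Submission
  imports Defs
begin

text \<open>
  A partial injection is determined by its domain \<open>A \<subseteq> N\<close> and an injective map \<open>A \<rightarrow> X\<close>; choosing
  \<open>A\<close> among the sets of size \<open>k\<close> and then the map gives \<open>\<Sum>k. (n choose k) * (x choose k) * k!\<close>.

  Each orbit set is counted by a complete invariant.  Permuting \<open>N\<close> changes a partial injection
  only by relabelling the sources of its arrows, so the invariant under the group of \<open>N\<close> is the
  range, and the ranges that occur are the subsets of \<open>X\<close> of size at most \<open>n\<close>
  (\<open>orbit_left_eq\<close>, \<open>Range_image_partial_injections\<close>).  Under the product group the range itself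
  can be moved to any set of the same size, so only the number of arrows survives
  (\<open>orbit_both_eq\<close>).  Passing to the converse relation exchanges \<open>N\<close> and \<open>X\<close>, hence the orbits
  under the group of \<open>X\<close> are those of the first case with the roles exchanged.

  The three rational generating functions follow by multiplying with one factor of the
  denominator at a time: \<open>1 - z\<close> and \<open>1 - w\<close> are difference operators that undo the summation over
  \<open>k\<close>, and the last factor expresses Pascal's recurrence, or the fact that the indicator of \<open>n = x\<close>
  is constant along diagonals.  For the exponential, write \<open>z + w + z w = w + z (1 + w)\<close>; the
  coefficient of \<open>z\<^sup>n\<close> in the \<open>k\<close>-th power is \<open>(k choose n) w\<^sup>k\<^sup>-\<^sup>n (1 + w)\<^sup>n\<close>, which leaves a finite
  sum of binomial coefficients to be compared with the count of partial injections.
\<close>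


section \<open>Counting partial injections\<close>

lemma partial_injections_iff:
  "R \<in> partial_injections N X \<longleftrightarrow> R \<subseteq> N \<times> X \<and> inj_on fst R \<and> inj_on snd R"
proof (cases "R \<subseteq> N \<times> X")
  case True
  have "inj_on fst R \<longleftrightarrow> (\<forall>i. \<exists>\<^sub>\<le>\<^sub>1 a. (i, a) \<in> R)"
    unfolding inj_on_def Uniq_def Ball_def split_paired_All fst_conv prod.inject by metis
  moreover have "inj_on snd R \<longleftrightarrow> (\<forall>a. \<exists>\<^sub>\<le>\<^sub>1 i. (i, a) \<in> R)"
    unfolding inj_on_def Uniq_def Ball_def split_paired_All snd_conv prod.inject by metis
  moreover have "(\<forall>i. \<exists>\<^sub>\<le>\<^sub>1 a. (i, a) \<in> R) \<longleftrightarrow> (\<forall>i\<in>N. \<exists>\<^sub>\<le>\<^sub>1 a. a \<in> X \<and> (i, a) \<in> R)"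
    using True unfolding Uniq_def by (meson mem_Sigma_iff subsetD)
  moreover have "(\<forall>a. \<exists>\<^sub>\<le>\<^sub>1 i. (i, a) \<in> R) \<longleftrightarrow> (\<forall>a\<in>X. \<exists>\<^sub>\<le>\<^sub>1 i. i \<in> N \<and> (i, a) \<in> R)"
    using True unfolding Uniq_def by (meson mem_Sigma_iff subsetD)
  ultimately show ?thesis using True by (simp add: partial_injections_def conj_commute)
qed (simp add: partial_injections_def)

lemma card_Domain_Range_partial_injection:
  assumes "R \<in> partial_injections N X"
  shows "card (fst ` R) = card R" "card (snd ` R) = card R"
  using assms by (simp_all add: partial_injections_iff card_image)

lemma prod_diff_eq_binomial_fact:
  "(\<Prod>i=0..<k. x - i) = (x choose k) * fact k" for x :: nat
proof (induction k)
  case (Suc k)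
  have "Suc k * (x choose Suc k) = (x - k) * (x choose k)"
    by (simp only: binomial_absorption binomial_absorb_comp)
  moreover have "(\<Prod>i=0..<Suc k. x - i) = fact k * ((x - k) * (x choose k))"
    by (simp only: prod.atLeast0_lessThan_Suc Suc mult_ac)
  ultimately show ?case by (simp only: fact_Suc of_nat_id mult_ac)
qed simp

lemma card_injections:
  assumes "finite A" "finite B"
  shows "card {f \<in> A \<rightarrow>\<^sub>E B. inj_on f A} = (card B choose card A) * fact (card A)"
  using card_inj_on_subset_funcset[OF assms subset_refl]
  by (simp add: prod_diff_eq_binomial_fact)

lemma sum_Pow_card:
  fixes g :: "nat \<Rightarrow> 'c::comm_semiring_1"
  assumes "finite N"
  shows "(\<Sum>A\<in>Pow N. g (card A)) = (\<Sum>k\<le>card N. of_nat (card N choose k) * g k)"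
proof -
  have "(\<Sum>A\<in>Pow N. g (card A)) = (\<Sum>k\<le>card N. \<Sum>A\<in>{A\<in>Pow N. card A = k}. g (card A))"
    using assms by (intro sum.group[symmetric]) (auto intro: card_mono)
  also have "\<dots> = (\<Sum>k\<le>card N. of_nat (card {A. A \<subseteq> N \<and> card A = k}) * g k)"
    by (intro sum.cong) auto
  finally show ?thesis using assms by (simp add: n_subsets)
qed

text \<open>The counting arguments produce sums up to \<open>n\<close> or up to \<open>x\<close> alone; their summands contain a
  factor that vanishes beyond the other bound, and this brings them to a common form.\<close>

lemma sum_atMost_min:
  fixes g :: "nat \<Rightarrow> 'c::comm_monoid_add"
  assumes "\<And>k. k > x \<Longrightarrow> g k = 0"
  shows "(\<Sum>k\<le>n. g k) = (\<Sum>k\<le>min n x. g k)"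
  using assms by (intro sum.mono_neutral_right) (auto simp: not_less[symmetric])

text \<open>The graph construction is a bijection from pairs of a domain and an injective map onto the
  partial injections.  Maps are taken extensional so that each partial injection comes from
  only one pair.\<close>

lemma bij_betw_graph_partial_injections:
  "bij_betw (\<lambda>(A, f). (\<lambda>i. (i, f i)) ` A)
     (SIGMA A:Pow N. {f \<in> A \<rightarrow>\<^sub>E X. inj_on f A}) (partial_injections N X)"
  (is "bij_betw ?G ?S _")
proof (rule bij_betw_imageI)
  show "inj_on ?G ?S"
  proof (rule inj_onI, clarsimp, rule conjI)
    fix A f B g
    assume f: "f \<in> A \<rightarrow>\<^sub>E X" and g: "g \<in> B \<rightarrow>\<^sub>E X"
      and eq: "(\<lambda>i. (i, f i)) ` A = (\<lambda>i. (i, g i)) ` B"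
    have "fst ` (\<lambda>i. (i, f i)) ` A = fst ` (\<lambda>i. (i, g i)) ` B" by (simp only: eq)
    then show AB: "A = B" by (simp add: image_image)
    show "f = g"
    proof (rule PiE_ext[OF f])
      show "g \<in> A \<rightarrow>\<^sub>E X" using g AB by simp
      show "f i = g i" if "i \<in> A" for i
      proof -
        have "(i, f i) \<in> (\<lambda>i. (i, g i)) ` B" using that eq by blast
        then show ?thesis by auto
      qed
    qed
  qed
  show "?G ` ?S = partial_injections N X"
  proof
    show "?G ` ?S \<subseteq> partial_injections N X"
      by (auto simp: partial_injections_iff inj_on_def)
    show "partial_injections N X \<subseteq> ?G ` ?S"
    proof
      fix R assume R: "R \<in> partial_injections N X"
      define A where "A = fst ` R"
      define f where "f = (\<lambda>i\<in>A. snd (inv_into R fst i))"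
      have inj: "inj_on fst R" "inj_on snd R" and sub: "R \<subseteq> N \<times> X"
        using R by (auto simp: partial_injections_iff)
      have f: "f (fst p) = snd p" if "p \<in> R" for p
        using that inj by (simp add: f_def A_def)
      have "(\<lambda>i. (i, f i)) ` A = R"
        by (auto simp: A_def image_image f)
      moreover have "A \<subseteq> N" using sub by (auto simp: A_def)
      moreover have "f \<in> A \<rightarrow>\<^sub>E X"
      proof (rule PiE_I)
        show "f i \<in> X" if "i \<in> A" for i using that f sub by (auto simp: A_def)
      qed (simp add: f_def)
      moreover have "inj_on f A"
        using inj(2) f by (fastforce simp: A_def inj_on_def)
      ultimately show "R \<in> ?G ` ?S"
        by (intro image_eqI[of _ _ "(A, f)"]) auto
    qed
  qed
qed

lemma card_partial_injections:
  assumes "finite N" "finite X"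
  shows "card (partial_injections N X) =
    (\<Sum>k\<le>min (card N) (card X). (card N choose k) * (card X choose k) * fact k)"
proof -
  have "card (partial_injections N X) = card (SIGMA A:Pow N. {f \<in> A \<rightarrow>\<^sub>E X. inj_on f A})"
    using bij_betw_same_card[OF bij_betw_graph_partial_injections] by metis
  also have "\<dots> = (\<Sum>A\<in>Pow N. card {f \<in> A \<rightarrow>\<^sub>E X. inj_on f A})"
  proof (intro card_SigmaI ballI)
    fix A assume "A \<in> Pow N"
    then have "finite (A \<rightarrow>\<^sub>E X)" using assms by (intro finite_PiE) (auto intro: finite_subset)
    then show "finite {f \<in> A \<rightarrow>\<^sub>E X. inj_on f A}" by simp
  qed (use assms in simp)
  also have "\<dots> = (\<Sum>A\<in>Pow N. (card X choose card A) * fact (card A))"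
    using assms by (intro sum.cong refl card_injections) (auto intro: finite_subset)
  also have "\<dots> = (\<Sum>k\<le>card N. (card N choose k) * (card X choose k) * fact k)"
    by (subst sum_Pow_card[OF assms(1)]) (simp add: mult.assoc)
  also have "\<dots> = (\<Sum>k\<le>min (card N) (card X). (card N choose k) * (card X choose k) * fact k)"
    by (rule sum_atMost_min) (simp add: binomial_eq_0)
  finally show ?thesis .
qed


section \<open>Orbits\<close>

lemma carrier_BijGroup: "carrier (BijGroup S) = Bij S"
  by (simp add: BijGroup_def)

text \<open>If the orbits are the fibres of a map, they correspond to its values.\<close>

lemma card_orbits_eq_card_invariant:
  assumes "\<And>R. R \<in> E \<Longrightarrow> orbit G \<phi> R = {R' \<in> E. f R' = f R}"
  shows "card (orbits G E \<phi>) = card (f ` E)"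
proof -
  have "orbits G E \<phi> = (\<lambda>v. {R' \<in> E. f R' = v}) ` f ` E"
    using assms by (auto simp: orbits_def)
  moreover have "inj_on (\<lambda>v. {R' \<in> E. f R' = v}) (f ` E)"
    by (auto simp: inj_on_def)
  ultimately show ?thesis by (simp add: card_image)
qed

lemma pinj_act_eq_map_prod:
  assumes "R \<in> partial_injections N X"
  shows "pinj_act N X (\<pi>, \<sigma>) R = map_prod \<pi> \<sigma> ` R"
  using assms by (force simp: pinj_act_def)

lemma pinj_act_left_eq_map_prod:
  assumes "R \<in> partial_injections N X"
  shows "pinj_act_left N X \<pi> R = map_prod \<pi> id ` R"
proof -
  have "map_prod \<pi> \<one>\<^bsub>BijGroup X\<^esub> ` R = map_prod \<pi> id ` R"
    using assms by (intro image_cong) (auto simp: partial_injections_iff BijGroup_def)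
  with assms show ?thesis by (simp add: pinj_act_left_def pinj_act_eq_map_prod)
qed

lemma pinj_act_right_eq_map_prod:
  assumes "R \<in> partial_injections N X"
  shows "pinj_act_right N X \<sigma> R = map_prod id \<sigma> ` R"
proof -
  have "map_prod \<one>\<^bsub>BijGroup N\<^esub> \<sigma> ` R = map_prod id \<sigma> ` R"
    using assms by (intro image_cong) (auto simp: partial_injections_iff BijGroup_def)
  with assms show ?thesis by (simp add: pinj_act_right_def pinj_act_eq_map_prod)
qed

lemma map_prod_partial_injection:
  assumes R: "R \<in> partial_injections N X"
    and \<pi>: "bij_betw \<pi> N N" and \<sigma>: "bij_betw \<sigma> X X"
  shows "map_prod \<pi> \<sigma> ` R \<in> partial_injections N X"
    and "card (map_prod \<pi> \<sigma> ` R) = card R"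
proof -
  have sub: "R \<subseteq> N \<times> X" and inj: "inj_on fst R" "inj_on snd R"
    using R by (auto simp: partial_injections_iff)
  have "inj_on (\<pi> \<circ> fst) R" "inj_on (\<sigma> \<circ> snd) R"
    using sub inj \<pi> \<sigma>
    by (auto intro!: comp_inj_on simp: bij_betw_def elim!: inj_on_subset)
  then have *: "inj_on (fst \<circ> map_prod \<pi> \<sigma>) R" "inj_on (snd \<circ> map_prod \<pi> \<sigma>) R"
    by (simp_all add: fst_comp_map_prod snd_comp_map_prod)
  have "map_prod \<pi> \<sigma> ` R \<subseteq> N \<times> X"
    using sub \<pi> \<sigma> by (auto simp: bij_betw_def)
  moreover have "inj_on fst (map_prod \<pi> \<sigma> ` R)" "inj_on snd (map_prod \<pi> \<sigma> ` R)"
    by (rule *[THEN inj_on_imageI])+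
  ultimately show "map_prod \<pi> \<sigma> ` R \<in> partial_injections N X"
    by (simp add: partial_injections_iff)
  show "card (map_prod \<pi> \<sigma> ` R) = card R"
    by (rule card_image) (rule inj_on_imageI2[OF *(1)])
qed

text \<open>On a finite set, the complements of equinumerous subsets are equinumerous, so a bijection
  between the subsets is completed by any bijection between the complements.\<close>

lemma extend_bij_betw_to_Bij:
  assumes "finite N" "A \<subseteq> N" "B \<subseteq> N" "bij_betw h A B"
  obtains \<pi> where "\<pi> \<in> Bij N" "\<And>i. i \<in> A \<Longrightarrow> \<pi> i = h i"
proof -
  have "card A = card B" using assms(4) by (rule bij_betw_same_card)
  then have "card (N - A) = card (N - B)"
    using assms by (simp add: card_Diff_subset finite_subset)
  then obtain g where g: "bij_betw g (N - A) (N - B)"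
    using assms(1) by (meson finite_Diff finite_same_card_bij)
  define \<pi> where "\<pi> = (\<lambda>i\<in>N. if i \<in> A then h i else g i)"
  have "bij_betw \<pi> A B"
    using assms by (subst bij_betw_cong[of _ _ h]) (auto simp: \<pi>_def)
  moreover have "bij_betw \<pi> (N - A) (N - B)"
    using g by (subst bij_betw_cong[of _ _ g]) (auto simp: \<pi>_def)
  ultimately have "bij_betw \<pi> (A \<union> (N - A)) (B \<union> (N - B))"
    by (rule bij_betw_combine) auto
  moreover have "A \<union> (N - A) = N" "B \<union> (N - B) = N" using assms by auto
  ultimately have "\<pi> \<in> Bij N" by (simp add: Bij_def \<pi>_def)
  moreover have "\<pi> i = h i" if "i \<in> A" for i using that assms(2) by (auto simp: \<pi>_def)
  ultimately show ?thesis by (rule that)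
qed

text \<open>Two partial injections with the same range match each element of the one domain with the
  element of the other domain that has the same image; a permutation extending this matching
  carries the one partial injection to the other.\<close>

lemma same_range_imp_permuted:
  assumes "finite N"
    and R: "R \<in> partial_injections N X" and S: "S \<in> partial_injections N X"
    and ran: "snd ` R = snd ` S"
  obtains \<pi> where "\<pi> \<in> Bij N" "map_prod \<pi> id ` R = S"
proof -
  have iR: "inj_on fst R" "inj_on snd R" "R \<subseteq> N \<times> X"
    and iS: "inj_on fst S" "inj_on snd S" "S \<subseteq> N \<times> X"
    using R S by (auto simp: partial_injections_iff)
  define h where "h = fst \<circ> inv_into S snd \<circ> snd \<circ> inv_into R fst"
  have "bij_betw (inv_into R fst) (fst ` R) R" "bij_betw snd R (snd ` S)"
    "bij_betw (inv_into S snd) (snd ` S) S" "bij_betw fst S (fst ` S)"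
    using iR iS ran by (auto intro!: bij_betw_inv_into simp: bij_betw_def inj_on_inv_into)
  then have "bij_betw h (fst ` R) (fst ` S)"
    unfolding h_def by (meson bij_betw_trans)
  moreover have "fst ` R \<subseteq> N" "fst ` S \<subseteq> N" using iR iS by auto
  ultimately obtain \<pi> where \<pi>: "\<pi> \<in> Bij N" "\<And>i. i \<in> fst ` R \<Longrightarrow> \<pi> i = h i"
    using extend_bij_betw_to_Bij[OF assms(1)] by metis
  have "map_prod \<pi> id p \<in> S" if p: "p \<in> R" for p
  proof -
    have "snd p \<in> snd ` S" using p ran by blast
    then have q: "inv_into S snd (snd p) \<in> S" "snd (inv_into S snd (snd p)) = snd p"
      by (auto intro: inv_into_into f_inv_into_f)
    have "\<pi> (fst p) = fst (inv_into S snd (snd p))"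
      using p iR(1) \<pi>(2) by (simp add: h_def)
    then have "map_prod \<pi> id p = inv_into S snd (snd p)"
      using q(2) by (simp add: prod_eq_iff)
    then show ?thesis using q(1) by simp
  qed
  then have sub: "map_prod \<pi> id ` R \<subseteq> S" by (rule image_subsetI)
  have "snd ` map_prod \<pi> id ` R = snd ` S"
    using ran by (simp add: image_image)
  then have "map_prod \<pi> id ` R = S"
    using inj_on_image_eq_iff[OF iS(2) sub subset_refl] by simp
  with \<pi>(1) show ?thesis by (rule that)
qed

lemma orbit_left_eq:
  assumes "finite N" and R: "R \<in> partial_injections N X"
  shows "orbit (BijGroup N) (pinj_act_left N X) R =
    {S \<in> partial_injections N X. snd ` S = snd ` R}"
proof (intro equalityI subsetI)
  fix S assume "S \<in> orbit (BijGroup N) (pinj_act_left N X) R"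
  then obtain \<pi> where "\<pi> \<in> Bij N" and S: "S = map_prod \<pi> id ` R"
    using R by (auto simp: orbit_def carrier_BijGroup pinj_act_left_eq_map_prod)
  then have "S \<in> partial_injections N X"
    using R by (auto simp: Bij_def intro!: map_prod_partial_injection)
  then show "S \<in> {S \<in> partial_injections N X. snd ` S = snd ` R}"
    by (simp add: S image_image)
next
  fix S assume "S \<in> {S \<in> partial_injections N X. snd ` S = snd ` R}"
  then obtain \<pi> where "\<pi> \<in> Bij N" "map_prod \<pi> id ` R = S"
    using same_range_imp_permuted[OF assms(1) R, of S] by auto
  then show "S \<in> orbit (BijGroup N) (pinj_act_left N X) R"
    using R by (auto simp: orbit_def carrier_BijGroup pinj_act_left_eq_map_prod)
qed

text \<open>Equal numbers of arrows suffice for the product group: a permutation of \<open>X\<close> first makes the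
  ranges equal, and a permutation of \<open>N\<close> then does the rest.\<close>

lemma orbit_both_eq:
  assumes fin: "finite N" "finite X" and R: "R \<in> partial_injections N X"
  shows "orbit (BijGroup N \<times>\<times> BijGroup X) (pinj_act N X) R =
    {S \<in> partial_injections N X. card S = card R}"
proof (intro equalityI subsetI)
  fix S assume "S \<in> orbit (BijGroup N \<times>\<times> BijGroup X) (pinj_act N X) R"
  then obtain \<pi> \<sigma> where "\<pi> \<in> Bij N" "\<sigma> \<in> Bij X" and S: "S = map_prod \<pi> \<sigma> ` R"
    using R by (auto simp: orbit_def carrier_BijGroup pinj_act_eq_map_prod)
  then show "S \<in> {S \<in> partial_injections N X. card S = card R}"
    using R by (auto simp: Bij_def map_prod_partial_injection)
next
  fix S assume "S \<in> {S \<in> partial_injections N X. card S = card R}"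
  then have S: "S \<in> partial_injections N X" "card S = card R" by auto
  have sub: "snd ` R \<subseteq> X" "snd ` S \<subseteq> X"
    using R S by (auto simp: partial_injections_iff)
  have "card (snd ` R) = card (snd ` S)"
    using R S card_Domain_Range_partial_injection(2) by metis
  then obtain h where "bij_betw h (snd ` R) (snd ` S)"
    using sub fin by (meson finite_same_card_bij finite_subset)
  then obtain \<sigma> where \<sigma>: "\<sigma> \<in> Bij X" "\<sigma> ` snd ` R = snd ` S"
    using extend_bij_betw_to_Bij[OF fin(2) sub] by (metis bij_betw_def image_cong)
  let ?T = "map_prod id \<sigma> ` R"
  have T: "?T \<in> partial_injections N X"
    using R \<sigma> by (auto simp: Bij_def intro!: map_prod_partial_injection)
  have "snd ` ?T = snd ` S" using \<sigma>(2) by (simp add: image_image)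
  then obtain \<pi> where \<pi>: "\<pi> \<in> Bij N" "map_prod \<pi> id ` ?T = S"
    using same_range_imp_permuted[OF fin(1) T S(1)] by metis
  have "map_prod \<pi> \<sigma> ` R = S"
    using \<pi>(2) by (simp add: image_image map_prod_def split_def)
  then show "S \<in> orbit (BijGroup N \<times>\<times> BijGroup X) (pinj_act N X) R"
    using R \<pi>(1) \<sigma>(1) by (auto simp: orbit_def carrier_BijGroup pinj_act_eq_map_prod)
qed

text \<open>A subset of \<open>X\<close> is a range as soon as \<open>N\<close> has enough elements to serve as the sources.\<close>

lemma Range_image_partial_injections:
  assumes fin: "finite N" "finite X"
  shows "(`) snd ` partial_injections N X = {B. B \<subseteq> X \<and> card B \<le> card N}"
proof (intro equalityI subsetI)
  fix B assume "B \<in> (`) snd ` partial_injections N X"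
  then obtain R where R: "R \<in> partial_injections N X" and B: "B = snd ` R" by auto
  have sub: "R \<subseteq> N \<times> X" using R by (simp add: partial_injections_iff)
  have "card B = card (fst ` R)"
    using R B card_Domain_Range_partial_injection by metis
  also have "\<dots> \<le> card N" using sub fin by (intro card_mono) auto
  finally show "B \<in> {B. B \<subseteq> X \<and> card B \<le> card N}" using B sub by auto
next
  fix B assume "B \<in> {B. B \<subseteq> X \<and> card B \<le> card N}"
  then have B: "B \<subseteq> X" "card B \<le> card N" by auto
  obtain h where h: "inj_on h B" "h ` B \<subseteq> N"
    using card_le_inj[of B N] B fin by (auto intro: finite_subset)
  define R where "R = (\<lambda>b. (h b, b)) ` B"
  have "R \<in> partial_injections N X"
    using h B by (auto simp: R_def partial_injections_iff inj_on_def)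
  moreover have "snd ` R = B" by (simp add: R_def image_image)
  ultimately show "B \<in> (`) snd ` partial_injections N X" by blast
qed

lemma card_pinj_orbits_left:
  assumes fin: "finite N" "finite X"
  shows "card (pinj_orbits_left N X) = (\<Sum>k\<le>min (card N) (card X). card X choose k)"
proof -
  have "card (pinj_orbits_left N X) = card ((`) snd ` partial_injections N X)"
    unfolding pinj_orbits_left_def
    by (rule card_orbits_eq_card_invariant) (rule orbit_left_eq[OF fin(1)])
  also have "\<dots> = card {B \<in> Pow X. card B \<le> card N}"
    by (simp add: Range_image_partial_injections[OF fin])
  also have "\<dots> = (\<Sum>B\<in>Pow X. if card B \<le> card N then 1 else 0)"
    using fin by (simp add: sum.If_cases Int_def)
  also have "\<dots> = (\<Sum>k\<le>card X. of_nat (card X choose k) * (if k \<le> card N then 1 else 0))"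
    by (rule sum_Pow_card[OF fin(2)])
  also have "\<dots> = (\<Sum>k\<le>min (card X) (card N). card X choose k)"
    by (subst sum_atMost_min[of "card N"]) (auto intro!: sum.cong)
  finally show ?thesis by (simp add: min.commute)
qed

lemma converse_image_partial_injections:
  "converse ` partial_injections N X = partial_injections X N"
proof -
  have sub: "R\<inverse> \<in> partial_injections X N" if "R \<in> partial_injections N X"
    for N :: "'c set" and X :: "'d set" and R
    using that by (auto simp: partial_injections_def)
  show ?thesis
  proof (intro equalityI subsetI)
    fix R assume "R \<in> partial_injections X N"
    then show "R \<in> converse ` partial_injections N X"
      using sub by (intro image_eqI[of _ _ "R\<inverse>"]) auto
  qed (use sub in auto)
qed

text \<open>The converse intertwines the action of the group of \<open>X\<close> as second factor with its action as
  first factor, so it maps orbits to orbits.\<close>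

lemma card_pinj_orbits_right_eq_left:
  "card (pinj_orbits_right N X) = card (pinj_orbits_left X N)"
proof -
  let ?E = "partial_injections N X"
  have mem: "R\<inverse> \<in> partial_injections X N" if "R \<in> ?E" for R
    using that converse_image_partial_injections[of N X] by blast
  have act: "pinj_act_left X N \<sigma> (R\<inverse>) = (pinj_act_right N X \<sigma> R)\<inverse>" if "R \<in> ?E" for \<sigma> R
    using that mem[OF that]
    by (force simp: pinj_act_left_eq_map_prod pinj_act_right_eq_map_prod)
  have orb: "orbit (BijGroup X) (pinj_act_left X N) (R\<inverse>) =
      converse ` orbit (BijGroup X) (pinj_act_right N X) R" if "R \<in> ?E" for R
    using that by (auto simp: orbit_def act)
  have "pinj_orbits_left X N =
      (\<lambda>R. orbit (BijGroup X) (pinj_act_left X N) (R\<inverse>)) ` ?E"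
    unfolding pinj_orbits_left_def orbits_def
      converse_image_partial_injections[of N X, symmetric] by auto
  also have "\<dots> = (`) converse ` pinj_orbits_right N X"
    unfolding pinj_orbits_right_def orbits_def by (auto simp: orb)
  finally have eq: "pinj_orbits_left X N = (`) converse ` pinj_orbits_right N X" .
  have "inj (converse :: ('a \<times> 'b) set \<Rightarrow> _)" by (auto simp: inj_on_def)
  then have "inj_on ((`) (converse :: ('a \<times> 'b) set \<Rightarrow> _)) (pinj_orbits_right N X)"
    by (auto simp: inj_on_def inj_image_eq_iff)
  then show ?thesis by (simp add: eq card_image)
qed

lemma card_pinj_orbits_right:
  assumes "finite N" "finite X"
  shows "card (pinj_orbits_right N X) = (\<Sum>k\<le>min (card N) (card X). card N choose k)"
  using assms
  by (simp only: card_pinj_orbits_right_eq_left card_pinj_orbits_left min.commute[of "card N"])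

lemma card_image_partial_injections:
  assumes fin: "finite N" "finite X"
  shows "card ` partial_injections N X = {..min (card N) (card X)}"
proof -
  have "card ` partial_injections N X = card ` (`) snd ` partial_injections N X"
    by (simp add: image_image card_Domain_Range_partial_injection cong: image_cong)
  also have "\<dots> = card ` {B. B \<subseteq> X \<and> card B \<le> card N}"
    by (simp only: Range_image_partial_injections[OF fin])
  also have "\<dots> = {..min (card N) (card X)}"
  proof (intro equalityI subsetI)
    fix k assume "k \<in> {..min (card N) (card X)}"
    then obtain B where "B \<subseteq> X" "card B = k"
      using obtain_subset_with_card_n[of k X] by auto
    with \<open>k \<in> _\<close> show "k \<in> card ` {B. B \<subseteq> X \<and> card B \<le> card N}" by auto
  qed (use fin in \<open>auto intro: card_mono\<close>)
  finally show ?thesis .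
qed

lemma card_pinj_orbits:
  assumes fin: "finite N" "finite X"
  shows "card (pinj_orbits N X) = 1 + min (card N) (card X)"
proof -
  have "card (pinj_orbits N X) = card (card ` partial_injections N X)"
    unfolding pinj_orbits_def
    by (rule card_orbits_eq_card_invariant) (rule orbit_both_eq[OF fin])
  then show ?thesis by (simp add: card_image_partial_injections[OF fin])
qed


section \<open>Generating functions\<close>

lemma fps2_nth [simp]: "fps_nth (fps_nth (fps2 a) n) x = a n x"
  by (simp add: fps2_def)

lemma fps2_eqI:
  assumes "\<And>n x. fps_nth (fps_nth F n) x = fps_nth (fps_nth G n) x"
  shows "F = G"
  using assms by (simp add: fps_eq_iff)

text \<open>The coefficient ring is a ring of power series and not a field, so the invertibility of the
  constant term of the denominator has to be supplied.\<close>

lemma fps2_eq_one_divideI: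
  fixes A D :: "'r::field fps fps"
  assumes eq: "A * D = 1" and nz: "fps_nth (fps_nth D 0) 0 \<noteq> 0"
  shows "A = 1 / D"
proof -
  have "fps_nth D 0 \<noteq> 0" using nz by auto
  then have "subdegree D = 0" by simp
  then have div: "1 / D = inverse D" by (simp add: fps_divide_def)
  have "D * inverse D = 1"
    unfolding fps_inverse_def by (intro fps_right_inverse right_inverse nz)
  then have "A = A * D * inverse D" by (simp add: mult.assoc)
  with eq div show ?thesis by simp
qed

lemma fps2_mult_one_minus_z:
  fixes a :: "nat \<Rightarrow> nat \<Rightarrow> 'r::comm_ring_1"
  shows "fps2 a * (1 - fps_z) = fps2 (\<lambda>n x. a n x - (if n = 0 then 0 else a (n - 1) x))"
  by (rule fps2_eqI) (simp add: algebra_simps)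

lemma fps2_mult_one_minus_w:
  fixes a :: "nat \<Rightarrow> nat \<Rightarrow> 'r::comm_ring_1"
  shows "fps2 a * (1 - fps_w) = fps2 (\<lambda>n x. a n x - (if x = 0 then 0 else a n (x - 1)))"
  by (rule fps2_eqI) (simp add: right_diff_distrib)

lemma fps2_mult_zw:
  fixes a :: "nat \<Rightarrow> nat \<Rightarrow> 'r::comm_ring_1"
  shows "fps2 a * (fps_z * fps_w) = fps2 (\<lambda>n x. if n = 0 \<or> x = 0 then 0 else a (n - 1) (x - 1))"
  by (rule fps2_eqI) (simp add: mult.assoc[symmetric])

lemma one_eq_fps2: "(1 :: 'r::comm_ring_1 fps fps) = fps2 (\<lambda>n x. if n = 0 \<and> x = 0 then 1 else 0)"
  by (rule fps2_eqI) simp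

lemma fps2_diff: "fps2 a - fps2 b = fps2 (\<lambda>n x. a n x - b n x :: 'r::comm_ring_1)"
  by (rule fps2_eqI) simp

lemma sum_min_binomial_left:
  "(\<Sum>k\<le>min n x. x choose k) = (\<Sum>k\<le>n. x choose k)"
  by (rule sum_atMost_min[symmetric]) (simp add: binomial_eq_0)

lemma sum_min_binomial_right:
  "(\<Sum>k\<le>min n x. n choose k) = (\<Sum>k\<le>x. n choose k)"
  using sum_min_binomial_left[where n = x and x = n] by (simp only: min.commute[of n x])

lemma fps2_left_orbits:
  "fps2 (\<lambda>n x. of_nat (\<Sum>k\<le>min n x. x choose k) :: 'r::field)
     = 1 / ((1 - fps_z) * (1 - fps_w - fps_z * fps_w))"
proof (rule fps2_eq_one_divideI)
  have z: "fps2 (\<lambda>n x. of_nat (\<Sum>k\<le>min n x. x choose k) :: 'r) * (1 - fps_z)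
      = fps2 (\<lambda>n x. of_nat (x choose n))"
    unfolding sum_min_binomial_left fps2_mult_one_minus_z
    by (intro arg_cong[where f = fps2] ext) (auto simp: gr0_conv_Suc)
  have "fps2 (\<lambda>n x. of_nat (x choose n) :: 'r) * (1 - fps_w - fps_z * fps_w) = 1"
    unfolding right_diff_distrib[of _ "1 - fps_w"] fps2_mult_one_minus_w fps2_mult_zw
      fps2_diff
    unfolding one_eq_fps2
    \<comment> \<open>Pascal's recurrence cancels everything but the corner.\<close>
    by (intro arg_cong[where f = fps2] ext) (auto simp: gr0_conv_Suc binomial_eq_0)
  with z show "fps2 (\<lambda>n x. of_nat (\<Sum>k\<le>min n x. x choose k) :: 'r) *
      ((1 - fps_z) * (1 - fps_w - fps_z * fps_w)) = 1"
    by (simp add: mult.assoc[symmetric])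
qed simp

lemma fps2_right_orbits:
  "fps2 (\<lambda>n x. of_nat (\<Sum>k\<le>min n x. n choose k) :: 'r::field)
     = 1 / ((1 - fps_w) * (1 - fps_z - fps_z * fps_w))"
proof (rule fps2_eq_one_divideI)
  have w: "fps2 (\<lambda>n x. of_nat (\<Sum>k\<le>min n x. n choose k) :: 'r) * (1 - fps_w)
      = fps2 (\<lambda>n x. of_nat (n choose x))"
    unfolding sum_min_binomial_right fps2_mult_one_minus_w
    by (intro arg_cong[where f = fps2] ext) (auto simp: gr0_conv_Suc)
  have "fps2 (\<lambda>n x. of_nat (n choose x) :: 'r) * (1 - fps_z - fps_z * fps_w) = 1"
    unfolding right_diff_distrib[of _ "1 - fps_z"] fps2_mult_one_minus_z fps2_mult_zw
      fps2_diff
    unfolding one_eq_fps2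
    by (intro arg_cong[where f = fps2] ext) (auto simp: gr0_conv_Suc binomial_eq_0)
  with w show "fps2 (\<lambda>n x. of_nat (\<Sum>k\<le>min n x. n choose k) :: 'r) *
      ((1 - fps_w) * (1 - fps_z - fps_z * fps_w)) = 1"
    by (simp add: mult.assoc[symmetric])
qed simp

text \<open>Differencing \<open>1 + min n x\<close> in \<open>n\<close> gives the indicator of \<open>n \<le> x\<close>, differencing this in \<open>x\<close>
  gives the indicator of the diagonal, and the factor \<open>1 - z w\<close> reduces the diagonal to the
  corner.\<close>

lemma fps2_both_orbits:
  "fps2 (\<lambda>n x. of_nat (1 + min n x) :: 'r::field)
     = 1 / ((1 - fps_z) * (1 - fps_w) * (1 - fps_z * fps_w))"
proof (rule fps2_eq_one_divideI)
  have z: "fps2 (\<lambda>n x. of_nat (1 + min n x) :: 'r) * (1 - fps_z)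
      = fps2 (\<lambda>n x. if n \<le> x then 1 else 0)"
    unfolding fps2_mult_one_minus_z
    by (intro arg_cong[where f = fps2] ext) (auto simp: gr0_conv_Suc min_def not_less_eq_eq)
  have w: "fps2 (\<lambda>n x. if n \<le> x then 1 else 0 :: 'r) * (1 - fps_w)
      = fps2 (\<lambda>n x. if n = x then 1 else 0)"
    unfolding fps2_mult_one_minus_w
    by (intro arg_cong[where f = fps2] ext) auto
  have zw: "fps2 (\<lambda>n x. if n = x then 1 else 0 :: 'r) * (1 - fps_z * fps_w) = 1"
    unfolding right_diff_distrib fps2_mult_zw mult_1_right fps2_diff
    unfolding one_eq_fps2
    by (intro arg_cong[where f = fps2] ext) auto
  show "fps2 (\<lambda>n x. of_nat (1 + min n x) :: 'r) *
      ((1 - fps_z) * (1 - fps_w) * (1 - fps_z * fps_w)) = 1"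
    unfolding mult.assoc[symmetric] z w zw ..
qed simp

lemma one_plus_fps_X_power_nth:
  "fps_nth ((1 + fps_X) ^ n) k = (of_nat (n choose k) :: 'r::field_char_0)"
  by (simp add: fps_binomial_of_nat[symmetric] binomial_gbinomial)

text \<open>By the binomial theorem for \<open>(w + z (1 + w))\<^sup>k\<close> in powers of \<open>z\<close>.  The factor \<open>w\<^sup>k\<^sup>-\<^sup>n\<close> shifts
  the coefficients of \<open>(1 + w)\<^sup>n\<close>, so terms with \<open>k - n > x\<close> vanish; the case distinction keeps the
  truncated subtractions harmless.\<close>

lemma power_z_w_zw_nth:
  fixes k n x :: nat
  shows "fps_nth (fps_nth ((fps_z + fps_w + fps_z * fps_w) ^ k) n) x =
    (if n \<le> k \<and> k - n \<le> x then of_nat (k choose n) * of_nat (n choose (x - (k - n)))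
     else 0 :: 'r::field_char_0)"
proof -
  let ?u = "1 + fps_X :: 'r fps"
  have "fps_z + fps_w + fps_z * fps_w = fps_z * fps_const ?u + fps_const fps_X"
    by (simp add: algebra_simps flip: fps_const_add)
  then have "(fps_z + fps_w + fps_z * fps_w) ^ k =
      (\<Sum>i\<le>k. of_nat (k choose i) * (fps_z * fps_const ?u) ^ i * fps_const fps_X ^ (k - i))"
    by (simp only: binomial_ring)
  also have "\<dots> = (\<Sum>i\<le>k. fps_const (of_nat (k choose i) * (fps_X ^ (k - i) * ?u ^ i)) * fps_X ^ i)"
    by (intro sum.cong refl)
      (simp add: power_mult_distrib fps_of_nat[symmetric] mult_ac flip: fps_const_mult)
  finally have "fps_nth ((fps_z + fps_w + fps_z * fps_w) ^ k) n =
      (\<Sum>i\<le>k. if n = i then of_nat (k choose i) * (fps_X ^ (k - i) * ?u ^ i) else 0)"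
    by (simp add: fps_sum_nth fps_X_power_nth if_distrib cong: if_cong)
  also have "\<dots> = (if n \<le> k then of_nat (k choose n) * (fps_X ^ (k - n) * ?u ^ n) else 0)"
    by simp
  finally show ?thesis
    by (auto simp: fps_of_nat[symmetric] fps_X_power_mult_nth one_plus_fps_X_power_nth)
qed

lemma fps2_partial_injections:
  "fps2 (\<lambda>n x. of_nat (\<Sum>k\<le>min n x. (n choose k) * (x choose k) * fact k) / (fact n * fact x)
      :: 'r::field_char_0) = fps2_exp (fps_z + fps_w + fps_z * fps_w)"
  unfolding fps2_exp_def
proof (intro arg_cong[where f = fps2] ext)
  fix n x :: nat
  let ?c = "\<lambda>k. fps_nth (fps_nth ((fps_z + fps_w + fps_z * fps_w) ^ k) n) x / fact k :: 'r"
  \<comment> \<open>Only exponents from \<open>n\<close> to \<open>n + x\<close> contribute; they are written as \<open>n + (x - j)\<close>, where \<open>j\<close>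
    is the number of factors \<open>z w\<close>.\<close>
  have "Sum_any ?c = (\<Sum>k\<in>{n..n + x}. ?c k)"
    by (rule Sum_any.expand_superset) (auto simp: power_z_w_zw_nth split: if_splits)
  also have "\<dots> = (\<Sum>j\<le>x. ?c (n + (x - j)))"
    by (rule sum.reindex_bij_witness[of _ "\<lambda>j. n + (x - j)" "\<lambda>k. n + x - k"]) auto
  also have "\<dots> = (\<Sum>j\<le>x. of_nat ((n choose j) * (x choose j) * fact j) / (fact n * fact x))"
  proof (intro sum.cong refl)
    fix j assume "j \<in> {..x}"
    then have j: "j \<le> x" by simp
    have "?c (n + (x - j)) =
        of_nat (n + (x - j) choose n) * of_nat (n choose j) / fact (n + (x - j))"
      using j by (simp add: power_z_w_zw_nth)
    also have "\<dots> = of_nat (n choose j) / (fact n * fact (x - j))"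
      by (simp add: binomial_fact)
    also have "\<dots> = of_nat ((n choose j) * (x choose j) * fact j) / (fact n * fact x)"
      using j by (simp add: binomial_fact field_simps)
    finally show "?c (n + (x - j)) =
        of_nat ((n choose j) * (x choose j) * fact j) / (fact n * fact x)" .
  qed
  also have "\<dots> = of_nat (\<Sum>k\<le>x. (n choose k) * (x choose k) * fact k) / (fact n * fact x)"
    by (simp add: sum_divide_distrib)
  also have "(\<Sum>k\<le>x. (n choose k) * (x choose k) * fact k) =
      (\<Sum>k\<le>min n x. (n choose k) * (x choose k) * fact k)"
    by (subst min.commute, rule sum_atMost_min) (simp add: binomial_eq_0)
  finally show "of_nat (\<Sum>k\<le>min n x. (n choose k) * (x choose k) * fact k) / (fact n * fact x)
      = Sum_any ?c" by simp
qed

lemma num_pinj_eq: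
  "num_pinj n x = (\<Sum>k\<le>min n x. (n choose k) * (x choose k) * fact k)"
  "num_pinj_left n x = (\<Sum>k\<le>min n x. x choose k)"
  "num_pinj_right n x = (\<Sum>k\<le>min n x. n choose k)"
  "num_pinj_both n x = 1 + min n x"
  by (simp_all add: num_pinj_def num_pinj_left_def num_pinj_right_def num_pinj_both_def
    card_partial_injections card_pinj_orbits_left card_pinj_orbits_right card_pinj_orbits)

theorem theorem14p1:
  shows "(\<forall>(N :: 'a set) (X :: 'b set). finite N \<longrightarrow> finite X \<longrightarrow>
            card (partial_injections N X) = num_pinj (card N) (card X) \<and>
            card (pinj_orbits_left N X) = num_pinj_left (card N) (card X) \<and>
            card (pinj_orbits_right N X) = num_pinj_right (card N) (card X) \<and>
            card (pinj_orbits N X) = num_pinj_both (card N) (card X))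
    \<and> (\<forall>n x. num_pinj n x = (\<Sum>k\<le>min n x. (n choose k) * (x choose k) * fact k))
    \<and> (\<forall>n x. num_pinj_left n x = (\<Sum>k\<le>min n x. x choose k))
    \<and> (\<forall>n x. num_pinj_right n x = (\<Sum>k\<le>min n x. n choose k))
    \<and> (\<forall>n x. num_pinj_both n x = 1 + min n x)
    \<and> fps2 (\<lambda>n x. of_nat (num_pinj n x) / (fact n * fact x) :: 'r::field_char_0)
        = fps2_exp (fps_z + fps_w + fps_z * fps_w)
    \<and> fps2 (\<lambda>n x. of_nat (num_pinj_left n x) :: 'r)
        = 1 / ((1 - fps_z) * (1 - fps_w - fps_z * fps_w))
    \<and> fps2 (\<lambda>n x. of_nat (num_pinj_right n x) :: 'r)
        = 1 / ((1 - fps_w) * (1 - fps_z - fps_z * fps_w))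
    \<and> fps2 (\<lambda>n x. of_nat (1 + min n x) :: 'r)
        = 1 / ((1 - fps_z) * (1 - fps_w) * (1 - fps_z * fps_w))"
  unfolding num_pinj_eq
    fps2_partial_injections fps2_left_orbits fps2_right_orbits fps2_both_orbits
  by (intro conjI allI impI refl)
    (simp_all add: card_partial_injections card_pinj_orbits_left card_pinj_orbits_right
      card_pinj_orbits)

end
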